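(* Fix $\alpha,\beta,\gamma\in\mathbb{Z}$ with $\alpha\neq 0$ and $\beta,\gamma$ not both zero. Let $h\ge 2$ be an integer that is odd or prime, let $t$ be an integer with $0\le t\le h$, and let $n,r\ge 0$ be integers. Then the following hold. (a) For an indeterminate $R$, if $n+r\ge 1$, then $$p_n(\alpha,R)=\sum_{k=0}^{n-1}\binom{n+r}{k+1}(-1)^k\,p_{k+1}\bigl(-\alpha,R+(n-1+r)\alpha\bigr)\,p_{n-1-k}(\alpha,R)+C_{n+r,n}(\alpha,R),$$ and (for all $n \ge 0$) $$p_n(\alpha,R)=\sum_{k=0}^{n-1}\binom{n}{k+1}(-1)^k\,p_{k+1}\bigl(-\alpha,R+(n-1)\alpha\bigr)\,p_{n-1-k}(\alpha,R)+[n=0].$$ (b) $$p_n(\alpha,\beta n+\gamma)\equiv\sum_{k=0}^{n}\binom{h}{k}(-\alpha)^k\,p_k\bigl(-\alpha,\beta n+\gamma+(h-1)\alpha\bigr)\,p_{n-k}(\alpha,\beta n+\gamma)\pmod h,$$ and the right-hand side equals $$\sum_{k=0}^{n}\binom{h}{k}\alpha^{n+k}\left(1-h-\frac{\beta n+\gamma}{\alpha}\right)_k\left(\frac{\beta n+\gamma}{\alpha}\right)_{n-k}.$$ (c) $$p_n(\alpha,\beta n+\gamma)\equiv\sum_{k=0}^{n}\binom{h}{k}\alpha^{n+(t+1)k}\left(1-h-\frac{\beta n+\gamma}{\alpha}\right)_k\left(\frac{\beta n+\gamma}{\alpha}\right)_{n-k}\pmod{h\alpha^t}.$$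
   Context: The generalized factorial product is $p_n(\alpha,R)=R(R+\alpha)(R+2\alpha)\cdots(R+(n-1)\alpha)$ for $n\ge1$, and $p_0(\alpha,R)=1$. The symbol $(x)_n=x(x+1)\cdots(x+n-1)$ is the Pochhammer symbol (rising factorial), with $(x)_0=1$. $[n=0]$ equals $1$ if $n=0$ and $0$ otherwise. For $h\ge1$, the $h$-th convergent function is the rational function $$\mathrm{Conv}_h(\alpha,R;z)=\cfrac{1}{1-Rz-\cfrac{\alpha R z^2}{1-(R+2\alpha)z-\cfrac{2\alpha(R+\alpha)z^2}{\ddots\;-\cfrac{(h-1)\alpha(R+(h-2)\alpha)z^2}{1-(R+2(h-1)\alpha)z}}}}=\frac{\mathrm{FP}_h(\alpha,R;z)}{\mathrm{FQ}_h(\alpha,R;z)},$$ whose denominator and numerator polynomials are given explicitly by $$\mathrm{FQ}_h(\alpha,R;z)=\sum_{k=0}^h\binom hk(-1)^k\Bigl(\prod_{j=0}^{k-1}(R+(h-1-j)\alpha)\Bigr)z^k,$$ $$\mathrm{FP}_h(\alpha,R;z)=\sum_{m=0}^{h-1}\left(\sum_{i=0}^m\binom hi(-1)^i p_i\bigl(-\alpha,R+(h-1)\alpha\bigr)p_{m-i}(\alpha,R)\right)z^m.$$ The numerator coefficients are $C_{h,k}(\alpha,R)=[z^k]\,\mathrm{FP}_h(\alpha,R;z)$, the coefficient of $z^k$ in $\mathrm{FP}_h(\alpha,R;z)$; in particular $C_{h,k}(\alpha,R)=0$ for $k\ge h$. *)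

theory Defs
  imports "HOL-Computational_Algebra.Computational_Algebra" "HOL-Number_Theory.Cong"
begin

definition gen_fact_prod :: "nat \<Rightarrow> 'a::comm_ring_1 \<Rightarrow> 'a \<Rightarrow> 'a" where
  "gen_fact_prod n \<alpha> R = (\<Prod>j<n. R + of_nat j * \<alpha>)"

text \<open>Numerator polynomial, in the variable \<open>z\<close>, of the \<open>h\<close>-th convergent
  (\<open>h \<ge> 1\<close>) of the J-fraction expansion of the ordinary generating function of
  \<open>gen_fact_prod n \<alpha> R\<close>. The coefficient ring \<open>'a\<close> contains \<open>\<alpha>\<close> and \<open>R\<close>;
  when \<open>R\<close> is an indeterminate, \<open>'a\<close> is itself a polynomial ring.\<close>

definition FP :: "nat \<Rightarrow> 'a::comm_ring_1 \<Rightarrow> 'a \<Rightarrow> 'a poly" where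
  "FP h \<alpha> R = (\<Sum>m<h. monom (\<Sum>i\<le>m. of_nat (h choose i) * (-1) ^ i
       * gen_fact_prod i (-\<alpha>) (R + of_int (int h - 1) * \<alpha>)
       * gen_fact_prod (m - i) \<alpha> R) m)"

definition conv_num_coeff :: "nat \<Rightarrow> nat \<Rightarrow> 'a::comm_ring_1 \<Rightarrow> 'a \<Rightarrow> 'a" where
  "conv_num_coeff h k \<alpha> R = coeff (FP h \<alpha> R) k"

end

theory Submission imports Defs begin

text \<open>
  The first part is the Chu--Vandermonde convolution
  \<open>p\<^sub>n(\<alpha>, x + y) = \<Sum>k\<le>n. (n choose k) p\<^sub>k(\<alpha>, x) p\<^sub>n\<^sub>-\<^sub>k(\<alpha>, y)\<close>
  (lemma \<open>gen_fact_prod_vandermonde\<close>) in disguise. Reversing all signs turns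
  \<open>(-1)\<^sup>k p\<^sub>k(-\<alpha>, R + (n - 1) \<alpha>)\<close> into \<open>p\<^sub>k(\<alpha>, -R - (n - 1) \<alpha>)\<close>, so the full
  alternating sum over \<open>k \<le> n\<close> collapses to \<open>p\<^sub>n(\<alpha>, -(n - 1) \<alpha>)\<close>, which has the factor
  \<open>0\<close> as soon as \<open>n \<ge> 1\<close>. Isolating the summand \<open>k = 0\<close> is the second recurrence. For the
  first one, the coefficient of the numerator polynomial is by definition such an alternating sum
  when \<open>r \<ge> 1\<close>, and isolating its summand \<open>k = 0\<close> again suffices; for \<open>r = 0\<close> the coefficient
  lies beyond the degree and vanishes, which is the second recurrence again.

  The congruences hold summand by summand: the summand \<open>k = 0\<close> is \<open>p\<^sub>n\<close> itself, and every other
  one vanishes. Since \<open>k (h choose k) = h (h - 1 choose k - 1)\<close>, it is enough that \<open>k\<close> divides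
  \<open>\<alpha>\<^sup>k p\<^sub>k(-\<alpha>, y)\<close>. Here the part of \<open>k\<close> built from primes of \<open>\<alpha>\<close> divides \<open>\<alpha>\<^sup>k\<close>, and the
  part coprime to \<open>\<alpha>\<close> divides one of the \<open>k\<close> terms of the arithmetic progression with difference
  \<open>-\<alpha>\<close> (lemma \<open>dvd_power_mult_gen_fact_prod\<close>). The further factor \<open>\<alpha>\<^sup>t\<^sup>k\<close> of the last
  congruence supplies \<open>\<alpha>\<^sup>t\<close> whenever \<open>k \<ge> 1\<close>. The Pochhammer forms result from taking \<open>\<alpha>\<close> out
  of each factor of the products.
\<close>

section \<open>Generalized factorial products\<close>

lemma gen_fact_prod_0 [simp]: "gen_fact_prod 0 a x = 1"
  by (simp add: gen_fact_prod_def)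

lemma gen_fact_prod_Suc: "gen_fact_prod (Suc n) a x = gen_fact_prod n a x * (x + of_nat n * a)"
  by (simp add: gen_fact_prod_def)

lemma gen_fact_prod_uminus: "gen_fact_prod n (- a) x = (-1) ^ n * gen_fact_prod n a (- x)"
  by (induction n) (simp_all add: gen_fact_prod_Suc algebra_simps)

lemma gen_fact_prod_eq_0:
  assumes "i < n"
  shows "gen_fact_prod n a (- (of_nat i * a)) = 0"
  unfolding gen_fact_prod_def by (rule prod_zero) (use assms in \<open>auto intro!: bexI[of _ i]\<close>)

lemma gen_fact_prod_eq_pochhammer:
  fixes a x :: "'a::field"
  assumes "a \<noteq> 0"
  shows "gen_fact_prod n a x = a ^ n * pochhammer (x / a) n"
  by (induction n) (use assms in \<open>simp_all add: gen_fact_prod_Suc pochhammer_Suc field_simps\<close>)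

lemma of_int_gen_fact_prod:
  "of_int (gen_fact_prod n a x) = gen_fact_prod n (of_int a) (of_int x)"
  by (simp add: gen_fact_prod_def)

text \<open>
  The induction step multiplies the summand of index \<open>k\<close> by
  \<open>x + y + n a = (x + k a) + (y + (n - k) a)\<close>; either part raises one of the two products by
  one factor, and Pascal's rule recombines the two resulting sums.
\<close>
lemma gen_fact_prod_vandermonde:
  fixes a x y :: "'a::comm_ring_1"
  shows "gen_fact_prod n a (x + y) =
     (\<Sum>k\<le>n. of_nat (n choose k) * gen_fact_prod k a x * gen_fact_prod (n - k) a y)"
proof (induction n)
  case 0
  show ?case by simp
next
  case (Suc n)
  let ?f = "\<lambda>k. gen_fact_prod k a x" and ?g = "\<lambda>k. gen_fact_prod k a y"
  let ?c = "\<lambda>k. of_nat (n choose k) :: 'a"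
  have "gen_fact_prod (Suc n) a (x + y) =
      (\<Sum>k\<le>n. ?c k * ?f k * ?g (n - k) * (x + y + of_nat n * a))"
    by (simp add: gen_fact_prod_Suc Suc.IH sum_distrib_right)
  also have "\<dots> = (\<Sum>k\<le>n. ?c k * ?f (Suc k) * ?g (n - k) + ?c k * ?f k * ?g (Suc n - k))"
  proof (rule sum.cong[OF refl])
    fix k assume "k \<in> {..n}"
    then have "k \<le> n" by simp
    then have "x + y + of_nat n * a = (x + of_nat k * a) + (y + of_nat (n - k) * a)"
      by (simp add: algebra_simps flip: distrib_right)
    with \<open>k \<le> n\<close> show "?c k * ?f k * ?g (n - k) * (x + y + of_nat n * a) =
        ?c k * ?f (Suc k) * ?g (n - k) + ?c k * ?f k * ?g (Suc n - k)"
      by (simp only: Suc_diff_le gen_fact_prod_Suc) (simp add: algebra_simps)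
  qed
  also have "\<dots> = (\<Sum>k\<le>n. ?c k * ?f (Suc k) * ?g (n - k)) +
      (\<Sum>k\<le>Suc n. ?c k * ?f k * ?g (Suc n - k))"
    by (simp add: sum.distrib binomial_eq_0)
  also have "\<dots> = (\<Sum>k\<le>Suc n. of_nat (Suc n choose k) * ?f k * ?g (Suc n - k))"
    by (simp add: sum.atMost_Suc_shift sum.distrib algebra_simps del: sum.atMost_Suc)
  finally show ?case .
qed

section \<open>Numerators of the convergents\<close>

text \<open>
  The coefficient of \<open>z\<^sup>m\<close> in the product of the denominator of the \<open>h\<close>-th convergent with the
  generating function of the products \<open>gen_fact_prod n a x\<close>.
\<close>
definition alternating_convolution :: "nat \<Rightarrow> nat \<Rightarrow> 'a::comm_ring_1 \<Rightarrow> 'a \<Rightarrow> 'a" where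
  "alternating_convolution h m a x =
     (\<Sum>i\<le>m. of_nat (h choose i) * (-1) ^ i
        * gen_fact_prod i (- a) (x + of_int (int h - 1) * a) * gen_fact_prod (m - i) a x)"

lemma conv_num_coeff_eq:
  "conv_num_coeff h m a x = (if m < h then alternating_convolution h m a x else 0)"
  by (simp add: conv_num_coeff_def FP_def alternating_convolution_def coeff_sum)

text \<open>
  For \<open>h = n\<close> the two base points \<open>- x - (n - 1) * a\<close> and \<open>x\<close> of the convolution add up to
  \<open>- ((n - 1) * a)\<close>, whose product of length \<open>n \<ge> 1\<close> reaches the factor \<open>0\<close>.
\<close>
lemma alternating_convolution_diagonal:
  "alternating_convolution n n a x = (if n = 0 then 1 else 0)"
proof (cases n)
  case 0
  then show ?thesis by (simp add: alternating_convolution_def)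
next
  case (Suc m)
  have "alternating_convolution n n a x =
      (\<Sum>i\<le>n. of_nat (n choose i) * gen_fact_prod i a (- x - of_nat m * a)
        * gen_fact_prod (n - i) a x)"
    unfolding alternating_convolution_def
    by (intro sum.cong refl)
      (simp add: Suc gen_fact_prod_uminus mult.assoc flip: power_mult_distrib)
  also have "\<dots> = gen_fact_prod n a (- (of_nat m * a))"
    by (simp flip: gen_fact_prod_vandermonde)
  also have "\<dots> = 0"
    by (rule gen_fact_prod_eq_0) (simp add: Suc)
  finally show ?thesis by (simp add: Suc)
qed

text \<open>The summand \<open>i = 0\<close> of the alternating convolution is the product itself.\<close>
lemma gen_fact_prod_recurrence:
  "gen_fact_prod m a x =
     (\<Sum>k<m. of_nat (h choose (k + 1)) * (-1) ^ k
        * gen_fact_prod (k + 1) (- a) (x + of_int (int h - 1) * a)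
        * gen_fact_prod (m - 1 - k) a x)
     + alternating_convolution h m a x"
proof -
  have "{..m} = insert 0 (Suc ` {..<m})"
    by (auto simp: image_iff) (metis Suc_le_lessD not0_implies_Suc lessThan_iff)
  then show ?thesis
    by (simp add: alternating_convolution_def sum.reindex sum_negf)
qed

section \<open>Divisibility of products of arithmetic progressions\<close>

text \<open>
  Collecting the primes of \<open>k\<close> that divide \<open>a\<close>: as long as \<open>k\<close> and \<open>a\<close> have a common factor,
  it can be split off at the cost of one power of \<open>a\<close>, and this happens at most \<open>k\<close> times
  because the cofactor decreases.
\<close>
lemma coprime_times_dvd_power:
  fixes a :: int and k :: nat
  assumes "k > 0"
  obtains u v where "k = u * v" "coprime (int u) a" "int v dvd a ^ k"
proof -
  have "\<exists>u v. k = u * v \<and> coprime (int u) a \<and> int v dvd a ^ k"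
    using assms
  proof (induction k rule: less_induct)
    case (less k)
    show ?case
    proof (cases "coprime (int k) a")
      case True
      then show ?thesis by (intro exI[of _ k] exI[of _ 1]) simp
    next
      case False
      define d where "d = nat (gcd (int k) a)"
      have d: "int d = gcd (int k) a" by (simp add: d_def)
      with False have "d \<noteq> 1" by (auto simp: coprime_iff_gcd_eq_1)
      have "int d dvd int k" "int d dvd a" by (simp_all add: d)
      then obtain j where j: "k = d * j" by auto
      with less.prems \<open>d \<noteq> 1\<close> have "0 < j" "1 < d" by (auto simp: Suc_lessI)
      then have "j < k" by (simp add: j)
      with less.IH \<open>0 < j\<close> obtain u v
        where uv: "j = u * v" "coprime (int u) a" "int v dvd a ^ j" by blast
      have "int (v * d) dvd a ^ Suc j"
        using mult_dvd_mono[OF \<open>int d dvd a\<close> uv(3)] by (simp add: mult.commute)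
      also have "a ^ Suc j dvd a ^ k" using \<open>j < k\<close> by (intro le_imp_power_dvd) simp
      finally show ?thesis using uv by (intro exI[of _ u] exI[of _ "v * d"]) (simp add: j)
    qed
  qed
  then show thesis using that by blast
qed

text \<open>A difference coprime to \<open>u\<close> runs through all residues modulo \<open>u\<close> within \<open>u\<close> terms.\<close>
lemma dvd_gen_fact_prod:
  fixes a y :: int
  assumes "coprime (int u) a" "0 < u" "u \<le> n"
  shows "int u dvd gen_fact_prod n a y"
proof -
  obtain b where b: "[a * b = 1] (mod int u)"
    using assms(1) by (metis cong_solve_coprime_int coprime_commute)
  define j where "j = nat ((- y * b) mod int u)"
  have j: "int j = (- y * b) mod int u" using assms(2) by (simp add: j_def)
  have "(- y * b) mod int u < int u" using assms(2) by simp
  with j assms(3) have "j < n" by linarith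
  have "[y + int j * a = y + (- y * b) * a] (mod int u)"
    by (intro cong_add cong_mult cong_refl) (simp add: j cong_def)
  also have "[y + (- y * b) * a = y - y * 1] (mod int u)"
    using cong_diff[OF cong_refl[of y] cong_scalar_left[OF b, of y]] by (simp add: algebra_simps)
  finally have "[y + int j * a = 0] (mod int u)" by simp
  then have "int u dvd y + int j * a" by (simp add: cong_0_iff)
  also have "\<dots> dvd gen_fact_prod n a y"
    using dvd_prodI[of "{..<n}" j "\<lambda>j. y + int j * a"] \<open>j < n\<close>
    by (simp add: gen_fact_prod_def)
  finally show ?thesis .
qed

lemma dvd_power_mult_gen_fact_prod:
  fixes a y :: int
  assumes "0 < k"
  shows "int k dvd a ^ k * gen_fact_prod k a y"
proof -
  obtain u v where uv: "k = u * v" "coprime (int u) a" "int v dvd a ^ k"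
    using coprime_times_dvd_power[OF assms] by blast
  with assms have "0 < u" "u \<le> k" by auto
  then have "int v * int u dvd a ^ k * gen_fact_prod k a y"
    by (intro mult_dvd_mono uv dvd_gen_fact_prod)
  moreover have "int k = int v * int u" using uv(1) by simp
  ultimately show ?thesis by simp
qed

text \<open>
  By \<open>k (h choose k) = h (h - 1 choose k - 1)\<close>, the binomial coefficient lacks at most the
  factor \<open>k\<close> for divisibility by \<open>h\<close>, and the product supplies that factor.
\<close>
lemma dvd_choose_mult_gen_fact_prod:
  fixes a y :: int
  assumes "0 < k"
  shows "int h dvd int (h choose k) * (a ^ k * gen_fact_prod k a y)"
proof -
  have "h dvd (h choose k) * k"
  proof (cases "h = 0")
    case False
    with assms show ?thesis
      by (metis Suc_times_binomial_eq dvd_triv_left gr0_implies_Suc neq0_conv)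
  qed (use assms in simp)
  then have "int h dvd int (h choose k) * int k" by (metis of_nat_dvd_iff of_nat_mult)
  also have "\<dots> dvd int (h choose k) * (a ^ k * gen_fact_prod k a y)"
    by (intro mult_dvd_mono dvd_refl dvd_power_mult_gen_fact_prod assms)
  finally show ?thesis .
qed

section \<open>Congruences modulo \<open>h\<close> and \<open>h \<alpha>\<^sup>t\<close>\<close>

text \<open>
  Only the summand \<open>k = 0\<close>, which is \<open>gen_fact_prod n a x\<close>, survives: for \<open>k \<ge> 1\<close> one factor
  \<open>a\<^sup>k\<close> makes the summand divisible by \<open>h\<close>, and the remaining \<open>a\<^sup>t\<^sup>k\<close> is divisible by \<open>a\<^sup>t\<close>.
  The convergent's denominator is the instance \<open>y = - (x + (h - 1) * a)\<close>.
\<close>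
lemma gen_fact_prod_cong:
  fixes a x y :: int
  shows "[gen_fact_prod n a x =
    (\<Sum>k\<le>n. int (h choose k) * a ^ ((t + 1) * k) * gen_fact_prod k a y
      * gen_fact_prod (n - k) a x)] (mod (int h * a ^ t))"
proof -
  have "int h * a ^ t dvd int (h choose k) * a ^ ((t + 1) * k) * gen_fact_prod k a y
      * gen_fact_prod (n - k) a x" if "k \<in> {..n} - {0}" for k
  proof -
    have "a ^ t dvd a ^ (t * k)" using that by (intro le_imp_power_dvd) simp
    moreover have "int h dvd int (h choose k) * (a ^ k * gen_fact_prod k a y)"
      using that by (intro dvd_choose_mult_gen_fact_prod) simp
    ultimately have "int h * a ^ t dvd
        (int (h choose k) * (a ^ k * gen_fact_prod k a y)) * a ^ (t * k)"
      by (intro mult_dvd_mono)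
    also have "\<dots> dvd int (h choose k) * a ^ ((t + 1) * k) * gen_fact_prod k a y
        * gen_fact_prod (n - k) a x"
      by (rule dvdI[of _ _ "gen_fact_prod (n - k) a x"]) (simp add: power_add mult_ac)
    finally show ?thesis .
  qed
  then have "int h * a ^ t dvd (\<Sum>k\<in>{..n} - {0}. int (h choose k) * a ^ ((t + 1) * k)
      * gen_fact_prod k a y * gen_fact_prod (n - k) a x)"
    by (rule dvd_sum)
  then show ?thesis
    by (simp add: sum.remove[of "{..n}" 0] cong_iff_dvd_diff)
qed

lemma of_int_convolution_eq_pochhammer:
  fixes a c :: int and h t n :: nat
  assumes "a \<noteq> 0"
  defines "x \<equiv> (of_int c :: rat) / of_int a"
  shows "of_int (\<Sum>k\<le>n. int (h choose k) * a ^ ((t + 1) * k)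
      * gen_fact_prod k a (- (c + (int h - 1) * a)) * gen_fact_prod (n - k) a c) =
    (\<Sum>k\<le>n. of_nat (h choose k) * of_int a ^ (n + (t + 1) * k)
      * pochhammer (1 - of_nat h - x) k * pochhammer x (n - k))"
proof -
  have y: "of_int (- (c + (int h - 1) * a)) / of_int a = 1 - of_nat h - x"
    using assms by (simp add: field_simps)
  have poch: "of_int (gen_fact_prod k a y) = of_int a ^ k * pochhammer (of_int y / of_int a :: rat) k"
    for k y
    using assms(1) by (simp add: of_int_gen_fact_prod gen_fact_prod_eq_pochhammer)
  have "(of_int a :: rat) ^ (n + (t + 1) * k) =
      of_int a ^ ((t + 1) * k) * of_int a ^ k * of_int a ^ (n - k)" if "k \<le> n" for k
    using that by (simp add: add_ac flip: power_add)
  then show ?thesis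
    unfolding of_int_sum of_int_mult of_int_power of_int_of_nat_eq poch y x_def[symmetric]
    by (intro sum.cong refl) (simp add: mult_ac)
qed

theorem proposition1:
  fixes \<alpha> \<beta> \<gamma> :: int and h t n r :: nat
  assumes "\<alpha> \<noteq> 0" and "\<beta> \<noteq> 0 \<or> \<gamma> \<noteq> 0"
    and "h \<ge> 2" and "odd h \<or> prime h" and "t \<le> h"
  shows
    "(let R = [:0, 1:] :: int poly; A = [:\<alpha>:] in
        (n + r \<ge> 1 \<longrightarrow>
          gen_fact_prod n A R =
            (\<Sum>k<n. of_nat ((n + r) choose (k + 1)) * (-1) ^ k
               * gen_fact_prod (k + 1) (- A) (R + of_int (int n - 1 + int r) * A)
               * gen_fact_prod (n - 1 - k) A R)
            + conv_num_coeff (n + r) n A R) \<and>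
        gen_fact_prod n A R =
          (\<Sum>k<n. of_nat (n choose (k + 1)) * (-1) ^ k
             * gen_fact_prod (k + 1) (- A) (R + of_int (int n - 1) * A)
             * gen_fact_prod (n - 1 - k) A R)
          + (if n = 0 then 1 else 0)) \<and>
     (let \<rho> = \<beta> * int n + \<gamma>;
          x = (of_int \<rho> :: rat) / of_int \<alpha>;
          S = (\<Sum>k\<le>n. int (h choose k) * (- \<alpha>) ^ k
                 * gen_fact_prod k (- \<alpha>) (\<rho> + (int h - 1) * \<alpha>)
                 * gen_fact_prod (n - k) \<alpha> \<rho>)
      in
        [gen_fact_prod n \<alpha> \<rho> = S] (mod int h) \<and>
        of_int S = (\<Sum>k\<le>n. of_nat (h choose k) * of_int \<alpha> ^ (n + k)
                     * pochhammer (1 - of_nat h - x) k * pochhammer x (n - k)) \<and>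
        (\<exists>s::int.
           of_int s = (\<Sum>k\<le>n. of_nat (h choose k) * of_int \<alpha> ^ (n + (t + 1) * k)
                        * pochhammer (1 - of_nat h - x) k * pochhammer x (n - k)) \<and>
           [gen_fact_prod n \<alpha> \<rho> = s] (mod (int h * \<alpha> ^ t))))"
proof -
  let ?\<rho> = "\<beta> * int n + \<gamma>"
  let ?T = "\<lambda>t. \<Sum>k\<le>n. int (h choose k) * \<alpha> ^ ((t + 1) * k)
    * gen_fact_prod k \<alpha> (- (?\<rho> + (int h - 1) * \<alpha>)) * gen_fact_prod (n - k) \<alpha> ?\<rho>"
  have S: "(\<Sum>k\<le>n. int (h choose k) * (- \<alpha>) ^ k
      * gen_fact_prod k (- \<alpha>) (?\<rho> + (int h - 1) * \<alpha>) * gen_fact_prod (n - k) \<alpha> ?\<rho>) = ?T 0"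
  proof (intro sum.cong refl)
    fix k
    have "(- \<alpha>) ^ k * gen_fact_prod k (- \<alpha>) (?\<rho> + (int h - 1) * \<alpha>) =
        \<alpha> ^ k * gen_fact_prod k \<alpha> (- (?\<rho> + (int h - 1) * \<alpha>))"
      unfolding gen_fact_prod_uminus mult.assoc[symmetric] by (simp flip: power_mult_distrib)
    then show "int (h choose k) * (- \<alpha>) ^ k * gen_fact_prod k (- \<alpha>) (?\<rho> + (int h - 1) * \<alpha>)
        * gen_fact_prod (n - k) \<alpha> ?\<rho> = int (h choose k) * \<alpha> ^ ((0 + 1) * k)
        * gen_fact_prod k \<alpha> (- (?\<rho> + (int h - 1) * \<alpha>)) * gen_fact_prod (n - k) \<alpha> ?\<rho>"
      by (simp add: mult.assoc)
  qed
  \<comment> \<open>For \<open>r = 0\<close> both sides vanish: the left one by Vandermonde, as \<open>n \<ge> 1\<close>, and the right one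
    because \<open>n\<close> exceeds the degree of the numerator.\<close>
  have num: "alternating_convolution (n + r) n a x = conv_num_coeff (n + r) n a x"
    if "n + r \<ge> 1" for a x :: "int poly"
    using that by (cases "r = 0") (auto simp: conv_num_coeff_eq alternating_convolution_diagonal)
  have shift: "int n - 1 + int r = int (n + r) - 1" by simp
  show ?thesis
    unfolding Let_def S shift
  proof (intro conjI impI)
    show "\<exists>s. of_int s = (\<Sum>k\<le>n. of_nat (h choose k) * of_int \<alpha> ^ (n + (t + 1) * k)
          * pochhammer (1 - of_nat h - (of_int ?\<rho> :: rat) / of_int \<alpha>) k
          * pochhammer (of_int ?\<rho> / of_int \<alpha>) (n - k)) \<and>
        [gen_fact_prod n \<alpha> ?\<rho> = s] (mod (int h * \<alpha> ^ t))"
      by (intro exI[of _ "?T t"] conjI of_int_convolution_eq_pochhammer gen_fact_prod_cong assms(1))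
  next
    assume "n + r \<ge> 1"
    then show "gen_fact_prod n [:\<alpha>:] [:0, 1:] =
        (\<Sum>k<n. of_nat ((n + r) choose (k + 1)) * (-1) ^ k
           * gen_fact_prod (k + 1) (- [:\<alpha>:]) ([:0, 1:] + of_int (int (n + r) - 1) * [:\<alpha>:])
           * gen_fact_prod (n - 1 - k) [:\<alpha>:] [:0, 1:])
        + conv_num_coeff (n + r) n [:\<alpha>:] [:0, 1:]"
      by (subst num[symmetric]) (assumption, rule gen_fact_prod_recurrence)
  next
    show "gen_fact_prod n [:\<alpha>:] [:0, 1:] =
        (\<Sum>k<n. of_nat (n choose (k + 1)) * (-1) ^ k
           * gen_fact_prod (k + 1) (- [:\<alpha>:]) ([:0, 1:] + of_int (int n - 1) * [:\<alpha>:])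
           * gen_fact_prod (n - 1 - k) [:\<alpha>:] [:0, 1:])
        + (if n = 0 then 1 else 0)"
      by (subst alternating_convolution_diagonal[symmetric]) (rule gen_fact_prod_recurrence)
  next
    show "[gen_fact_prod n \<alpha> ?\<rho> = ?T 0] (mod int h)"
      using gen_fact_prod_cong[where t = 0] by simp
  next
    show "of_int (?T 0) = (\<Sum>k\<le>n. of_nat (h choose k) * of_int \<alpha> ^ (n + k)
        * pochhammer (1 - of_nat h - (of_int ?\<rho> :: rat) / of_int \<alpha>) k
        * pochhammer (of_int ?\<rho> / of_int \<alpha>) (n - k))"
      by (rule trans[OF of_int_convolution_eq_pochhammer[OF assms(1), where t = 0]]) simp
  qed
qed

end
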